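(* Let $q$ be a positive integer such that $p = 2^q - 1$ and $N = 2^p - 1$ are both (Mersenne) primes. Assume that $\sum_{j=0}^{q-1} 2^{2^j} = 2^1 + 2^{2^1} + 2^{2^2} + \cdots + 2^{2^{q-1}}$ is not divisible by $N$. Let $r$ be the smallest positive integer such that $$\Big(1 + \sum_{j=0}^{q-1} 2^{2^j}\Big) + r \sum_{j=0}^{q-1} 2^{2^j} \equiv 0 \pmod N.$$ Then for all $k = 1, 2, \ldots$ and all $i = 0, 1, 2, \ldots$, $$1 + 2^{2^{kq}} + 2^{2^{kq+1}} + \cdots + 2^{2^{kq + m}} \equiv 0 \pmod N, \qquad \text{where } m = (q-1) + rq + qNi.$$
   Context: A Mersenne prime is a prime number of the form $2^t - 1$ with $t$ a positive integer. The sum $2^{2^{kq}} + 2^{2^{kq+1}} + \cdots + 2^{2^{kq+m}}$ means $\sum_{j=0}^{m} 2^{2^{kq+j}}$. *)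

theory Defs
  imports "HOL-Number_Theory.Number_Theory"
begin

definition mersenne_prime :: "nat \<Rightarrow> bool" where
  "mersenne_prime n \<longleftrightarrow> prime n \<and> (\<exists>t>0. n = 2 ^ t - 1)"

end

theory Submission
  imports Defs
begin

text \<open>
  Modulo \<open>c ^ n - 1\<close> the power \<open>c ^ a\<close> depends only on the residue of \<open>a\<close> modulo \<open>n\<close>.
  Applied twice, this shows that \<open>2 ^ (2 ^ j)\<close> modulo \<open>N = 2 ^ (2 ^ q - 1) - 1\<close> is periodic in \<open>j\<close>
  with period \<open>q\<close>. Hence any sum of these terms over \<open>n\<close> full periods, starting at a multiple of \<open>q\<close>,
  is congruent to \<open>n * S\<close>, where \<open>S\<close> is the sum over the first period
  (\<open>sum_over_periods_cong\<close>). The sum in the theorem has \<open>m + 1 = q * (1 + r + N * i)\<close> terms,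
  so it is congruent to \<open>(1 + r + N * i) * S\<close>, hence to \<open>S + r * S\<close>, and adding \<open>1\<close> gives \<open>0\<close>
  by the choice of \<open>r\<close>. That a suitable \<open>r\<close> exists is where the primality of \<open>N\<close> enters:
  as \<open>N\<close> does not divide \<open>S\<close>, it makes \<open>S\<close> invertible modulo \<open>N\<close>.
\<close>

lemma power_cong_mod_power_minus_1:
  fixes c :: nat
  assumes "c > 0" and "[a = b] (mod n)"
  shows "[c ^ a = c ^ b] (mod (c ^ n - 1))"
proof -
  have one: "[c ^ n = 1] (mod (c ^ n - 1))"
    using assms(1) by (subst cong_altdef_nat) (auto simp: Suc_leI)
  have reduce: "[c ^ x = c ^ (x mod n)] (mod (c ^ n - 1))" for x
  proof -
    have "c ^ x = (c ^ n) ^ (x div n) * c ^ (x mod n)"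
      by (simp flip: power_mult power_add)
    then show ?thesis
      using cong_scalar_right[OF cong_pow[OF one, of "x div n"], of "c ^ (x mod n)"] by simp
  qed
  show ?thesis
    using reduce[of a] reduce[of b] assms(2) by (metis cong_def)
qed

lemma two_power_two_power_periodic:
  "[2 ^ (2 ^ (k * q + j)) = 2 ^ (2 ^ j)] (mod (2 ^ (2 ^ q - 1) - 1 :: nat))"
proof -
  have "[k * q + j = j] (mod q)"
    by (simp add: cong_def)
  then show ?thesis
    by (intro power_cong_mod_power_minus_1) simp_all
qed

lemma sum_over_periods_cong:
  fixes f :: "nat \<Rightarrow> nat"
  assumes periodic: "\<And>k j. [f (k * q + j) = f j] (mod N)"
  shows "[(\<Sum>j<n * q. f (k * q + j)) = n * (\<Sum>j<q. f j)] (mod N)"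
proof (induction n)
  case 0
  show ?case by simp
next
  case (Suc n)
  have split: "(\<Sum>j<a + b. g j) = (\<Sum>j<a. g j) + (\<Sum>j<b. g (a + j))"
    for a b and g :: "nat \<Rightarrow> nat"
    by (induction b) simp_all
  have "(\<Sum>j<Suc n * q. f (k * q + j)) =
        (\<Sum>j<n * q. f (k * q + j)) + (\<Sum>j<q. f ((k + n) * q + j))"
    using split[of "\<lambda>j. f (k * q + j)" "n * q" q] by (simp add: algebra_simps)
  moreover have "[(\<Sum>j<q. f ((k + n) * q + j)) = (\<Sum>j<q. f j)] (mod N)"
    by (intro cong_sum periodic)
  ultimately show ?case
    using cong_add[OF Suc.IH] by (simp only: mult_Suc add.commute[of "\<Sum>j<q. f j"])
qed

text \<open>
  Solving \<open>b + x * s = 0\<close> modulo \<open>n\<close> amounts to inverting \<open>s\<close>. Adding \<open>n\<close> to a solution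
  makes it positive.
\<close>

lemma positive_solution_of_linear_cong:
  fixes b s n :: nat
  assumes "coprime s n" and "n > 0"
  shows "\<exists>x>0. [b + x * s = 0] (mod n)"
proof -
  obtain y where y: "[s * y = 1] (mod n)"
    using cong_solve_coprime_nat[OF assms(1)] by auto
  \<comment> \<open>The factor \<open>n - 1\<close> plays the role of \<open>- 1\<close> modulo \<open>n\<close>.\<close>
  define x where "x = y * ((n - 1) * b) + n"
  have "[b + (s * y) * ((n - 1) * b) + n * s = b + 1 * ((n - 1) * b) + n * s] (mod n)"
    by (intro cong_add cong_mult y cong_refl)
  also have "b + 1 * ((n - 1) * b) + n * s = n * (b + s)"
    using assms(2) by (cases n) (simp_all add: algebra_simps)
  also have "[n * (b + s) = 0] (mod n)"
    by (simp add: cong_0_iff)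
  finally have "[b + x * s = 0] (mod n)"
    by (simp add: x_def algebra_simps)
  then show ?thesis
    using assms(2) by (intro exI[of _ x]) (simp add: x_def)
qed

theorem theorem2:
  fixes q p N r :: nat
  assumes "q > 0"
    and "p = 2 ^ q - 1" and "mersenne_prime p"
    and "N = 2 ^ p - 1" and "mersenne_prime N"
    and "\<not> N dvd (\<Sum>j=0..q - 1. 2 ^ (2 ^ j))"
    and "r = (LEAST r. r > 0 \<and>
           [(1 + (\<Sum>j=0..q - 1. 2 ^ (2 ^ j))) + r * (\<Sum>j=0..q - 1. 2 ^ (2 ^ j)) = 0] (mod N))"
  shows "\<forall>k\<ge>1. \<forall>i m. m = (q - 1) + r * q + q * N * i \<longrightarrow>
           [1 + (\<Sum>j=0..m. 2 ^ (2 ^ (k * q + j))) = 0] (mod N)"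
proof (intro allI impI)
  fix k i m :: nat
  assume m: "m = (q - 1) + r * q + q * N * i"
  define S :: nat where "S = (\<Sum>j=0..q - 1. 2 ^ (2 ^ j))"
  have "prime N"
    using assms(5) by (simp add: mersenne_prime_def)
  then have "coprime S N"
    using assms(6) by (metis S_def coprime_commute prime_imp_coprime)
  then have "\<exists>x>0. [1 + S + x * S = 0] (mod N)"
    using positive_solution_of_linear_cong prime_gt_0_nat[OF \<open>prime N\<close>] by blast
  then have r: "[1 + S + r * S = 0] (mod N)"
    using LeastI_ex assms(7) unfolding S_def by (metis (mono_tags, lifting))
  have S: "S = (\<Sum>j<q. 2 ^ (2 ^ j))"
    unfolding S_def using assms(1) by (intro sum.cong) auto
  have "{0..m} = {..<(1 + r + N * i) * q}"
    using assms(1) m by (auto simp: algebra_simps)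
  then have "[(\<Sum>j=0..m. 2 ^ (2 ^ (k * q + j))) = (1 + r + N * i) * S] (mod N)"
    unfolding S using two_power_two_power_periodic assms(2,4)
    by (simp only: sum_over_periods_cong[where f = "\<lambda>j. 2 ^ (2 ^ j)"])
  then have "[1 + (\<Sum>j=0..m. 2 ^ (2 ^ (k * q + j))) = 1 + (1 + r + N * i) * S] (mod N)"
    by (intro cong_add cong_refl)
  also have "1 + (1 + r + N * i) * S = (1 + S + r * S) + N * (i * S)"
    by (simp add: algebra_simps)
  also have "[(1 + S + r * S) + N * (i * S) = 0] (mod N)"
    using r by (simp add: cong_def)
  finally show "[1 + (\<Sum>j=0..m. 2 ^ (2 ^ (k * q + j))) = 0] (mod N)" .
qed

end
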